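(* Let $b(n,m)$ be the number of words in $\mathcal{L}_n$ containing exactly $m$ ones, and let $B(x,v)=\sum_{n\ge1}\sum_{m=0}^{n-1}b(n,m)x^nv^m$. Then, as formal power series, $$B(x,v)=\frac{x\left(1-x+x^2v+xv(x-2)C(x)+x^2v^2C(x)^2\right)}{(1-x)(1-xvC(x))(1-x-xvC(x))},$$ and, for all integers $n,m$ with $2\le m\le n$, $$b(n,m)=\sum_{j=m}^{n-1}\frac{m-1}{n+m-j-2}\binom{2n+m-2j-4}{n-j-1}\left(\binom{j}{m}-1\right).$$
   Context: For a positive integer $n$, $\mathcal{L}_n$ denotes the set of all words $a=(a_1,a_2,\ldots,a_n)$ over the alphabet of non-negative integers satisfying: (i) $a_{i+1}\ge a_i-1$ for $1\le i<n$; and (ii) if $a_i=k>0$ with $i$ minimal (i.e. $i$ is the position of the left-most occurrence of the letter $k$), then there exist $i_1<i<i_2$ such that $a_{i_1}=a_{i_2}=k-1$. $C(x)=\sum_{n\ge0}C_nx^n=\frac{1-\sqrt{1-4x}}{2x}$, where $C_n=\frac{1}{n+1}\binom{2n}{n}$ is the $n$-th Catalan number. An empty sum is $0$. *)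

theory Defs
  imports "HOL-Computational_Algebra.Computational_Algebra"
begin

text \<open>Words are lists of naturals, so positions run from 0 to n - 1.\<close>

definition words :: "nat \<Rightarrow> nat list set" where
  "words n = {a. length a = n \<and>
     (\<forall>i. Suc i < n \<longrightarrow> int (a ! Suc i) \<ge> int (a ! i) - 1) \<and>
     (\<forall>i<n. a ! i > 0 \<and> (\<forall>j<i. a ! j \<noteq> a ! i) \<longrightarrow>
        (\<exists>i1 i2. i1 < i \<and> i < i2 \<and> i2 < n \<and>
           a ! i1 = a ! i - 1 \<and> a ! i2 = a ! i - 1))}"

definition b :: "nat \<Rightarrow> nat \<Rightarrow> nat" where
  "b n m = card {a \<in> words n. count_list a 1 = m}"

text \<open>
  Bivariate power series in x and v are represented as power series in x
  whose coefficients are power series in v.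
\<close>

abbreviation x_var :: "rat fps fps" where
  "x_var \<equiv> fps_X"

abbreviation v_var :: "rat fps fps" where
  "v_var \<equiv> fps_const fps_X"

definition catalan :: "nat \<Rightarrow> rat" where
  "catalan n = 1 / of_nat (n + 1) * of_nat ((2 * n) choose n)"

definition C_series :: "rat fps fps" where
  "C_series = Abs_fps (\<lambda>n. fps_const (catalan n))"

definition B_series :: "rat fps fps" where
  "B_series = Abs_fps (\<lambda>n. Abs_fps (\<lambda>m.
     if 1 \<le> n \<and> m \<le> n - 1 then of_nat (b n m) else 0))"

text \<open>
  The sets counted by \<^const>\<open>b\<close> are finite, so that \<^const>\<open>card\<close> is the
  genuine number of elements.
\<close>

lemma words_bounded:
  assumes "a \<in> words n" "i < n"
  shows "a ! i \<le> i"
  using assms(2)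
proof (induction i rule: less_induct)
  case (less i)
  show ?case
  proof (cases "a ! i > 0 \<and> (\<forall>j<i. a ! j \<noteq> a ! i)")
    case True
    then obtain i1 where "i1 < i" "a ! i1 = a ! i - 1"
      using assms(1) less.prems unfolding words_def by blast
    then show ?thesis using less.IH[of i1] less.prems by linarith
  next
    case False
    then consider "a ! i = 0" | j where "j < i" "a ! j = a ! i" by blast
    then show ?thesis
    proof cases
      case 2
      then show ?thesis using less.IH[of j] less.prems by linarith
    qed simp
  qed
qed

lemma finite_words: "finite (words n)"
proof (rule finite_subset)
  show "words n \<subseteq> {a. set a \<subseteq> {..n} \<and> length a = n}"
  proof
    fix a assume a: "a \<in> words n"
    then have "length a = n" by (simp add: words_def)
    moreover have "set a \<subseteq> {..n}"
      using words_bounded[OF a] \<open>length a = n\<close> by (fastforce simp: in_set_conv_nth)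
    ultimately show "a \<in> {a. set a \<subseteq> {..n} \<and> length a = n}" by simp
  qed
qed (simp add: finite_lists_length_eq)

text \<open>
  The coefficient ring \<^typ>\<open>rat fps\<close> is not a field, but division by a series with
  constant coefficient 1 (in x) is still genuine division.
\<close>

lemma fps_fps_divide_unit:
  fixes f g :: "rat fps fps"
  assumes "fps_nth g 0 = 1"
  shows "f / g * g = f"
proof -
  have "inverse (fps_nth g 0) = 1"
    unfolding assms by (rule fps_inverse_one)
  then have "inverse g = fps_right_inverse g 1"
    by (simp only: fps_inverse_def)
  then have "inverse g * g = 1"
    using fps_left_inverse'[of 1 g 1] assms by simp
  moreover have "f / g = f * inverse g"
    using assms by (intro fps_divide_unit) simp
  ultimately show ?thesis by (simp add: mult.assoc)
qed

end

theory Submission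
  imports Defs
begin

text \<open>
  Keep the letters 0 and 1 of a word in \<^const>\<open>words\<close> and call them its bottom; keep the letters
  that are at least 1, lowered by 1, and call them its upper part. The requirement on the
  first occurrence of \<open>k + 1\<close> only sees the letters \<open>k\<close> and \<open>k + 1\<close>, so it passes to the bottom for \<open>k = 0\<close> and to the upper part for
  \<open>k \<ge> 1\<close>. Since letters drop by at most 1, a run of letters that are at least 2 is followed by a
  1 or ends the word. Hence the two parts determine how they are interleaved: every 0 of the
  bottom is written before the large letters that precede the next 1. A word with \<open>z\<close> zeros and
  \<open>m\<close> ones therefore is the same thing as a binary word with these counts in which a 0 occurs
  before and after the first 1, if there is a 1, together with an arbitrary word with \<open>m\<close> zeros
  among \<^const>\<open>words\<close>, the upper part (lemma \<open>bij_betw_bottom_upper\<close>). For \<open>z, m > 0\<close> there are \<open>(z + m - 1 choose m) - 1\<close> such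
  binary words.

  Summing this over \<open>m\<close> gives a recurrence for the number of words with a given number of zeros.
  Its solution is a ballot number: there are \<open>[x^k] C(x)^z\<close> words of length \<open>z + 1 + k\<close> with
  \<open>z + 1\<close> zeros. That the powers of \<open>C\<close> solve the recurrence is a substitution: writing
  \<open>w = 1 / (1 - x)\<close>, the series \<open>w^(z+1) - w\<close> has the coefficients
  \<open>(z + m choose m) - 1\<close>, and replacing \<open>x\<close> by \<open>x C\<close> turns \<open>w\<close> into \<open>C\<close>, because
  \<open>C = 1 + x C^2\<close>.

  Summing over \<open>z\<close> instead gives, with \<open>j = z + m - 1\<close>,
  \<open>b(n, m) = (\<Sum>j = m..n-1. ((j choose m) - 1) [x^(n-1-j)] C(x)^(m-1))\<close> for \<open>m \<ge> 1\<close> (lemma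
  \<open>b_eq_ballot_sum\<close>). The closed form of the ballot numbers makes this the stated formula.
  Read as a convolution, it says that the coefficient of \<open>v^m\<close> in \<open>B\<close> is
  \<open>x^(m+1) C^(m-1) (w^(m+1) - w)\<close>, so that \<open>B\<close> is a combination of two geometric series in \<open>v\<close>.
\<close>

section \<open>The defining conditions in terms of lists\<close>

text \<open>
  The condition on the first occurrence of \<open>k + 1\<close>, phrased with list operations that commute
  with filtering and relabelling. The list that \<^const>\<open>dropWhile\<close> returns still starts with the
  letter \<open>k + 1\<close>, which is harmless as that letter is not \<open>k\<close>.
\<close>

definition straddled :: "nat \<Rightarrow> nat list \<Rightarrow> bool" where
  "straddled k a \<longleftrightarrow> (Suc k \<in> set a \<longrightarrow>
     k \<in> set (takeWhile (\<lambda>x. x \<noteq> Suc k) a) \<and> k \<in> set (dropWhile (\<lambda>x. x \<noteq> Suc k) a))"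

lemma straddled_nth:
  assumes "i < length a" "a ! i = Suc k" "\<forall>j<i. a ! j \<noteq> Suc k"
  shows "straddled k a \<longleftrightarrow>
    (\<exists>i1 i2. i1 < i \<and> i < i2 \<and> i2 < length a \<and> a ! i1 = k \<and> a ! i2 = k)"
proof -
  have tw: "takeWhile (\<lambda>x. x \<noteq> Suc k) a = take i a"
    using assms by (intro takeWhile_eq_take_P_nth) auto
  have dw: "dropWhile (\<lambda>x. x \<noteq> Suc k) a = Suc k # drop (Suc i) a"
    using assms by (simp add: dropWhile_eq_drop tw Cons_nth_drop_Suc[symmetric])
  have "k \<in> set (take i a) \<longleftrightarrow> (\<exists>i1<i. a ! i1 = k)"
    using assms(1) by (auto simp: in_set_conv_nth)
  moreover have "k \<in> set (drop (Suc i) a) \<longleftrightarrow> (\<exists>i2>i. i2 < length a \<and> a ! i2 = k)"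
  proof
    assume "k \<in> set (drop (Suc i) a)"
    then obtain j where "j < length a - Suc i" "a ! (Suc i + j) = k"
      using assms(1) by (auto simp: in_set_conv_nth)
    then show "\<exists>i2>i. i2 < length a \<and> a ! i2 = k"
      by (intro exI[of _ "Suc i + j"]) auto
  next
    assume "\<exists>i2>i. i2 < length a \<and> a ! i2 = k"
    then obtain i2 where "i2 > i" "i2 < length a" "a ! i2 = k" by blast
    then show "k \<in> set (drop (Suc i) a)"
      by (auto simp: in_set_conv_nth intro!: exI[of _ "i2 - Suc i"])
  qed
  moreover have "Suc k \<in> set a" using assms by (metis nth_mem)
  ultimately show ?thesis unfolding straddled_def tw dw by auto
qed

lemma words_iff:
  "a \<in> words n \<longleftrightarrow>
     length a = n \<and> successively (\<lambda>x y. x \<le> Suc y) a \<and> (\<forall>k. straddled k a)"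
proof -
  have "successively (\<lambda>x y. x \<le> Suc y) a \<longleftrightarrow>
      (\<forall>i. Suc i < length a \<longrightarrow> int (a ! Suc i) \<ge> int (a ! i) - 1)"
    by (auto simp: successively_conv_nth)
  moreover have "(\<forall>k. straddled k a) \<longleftrightarrow>
      (\<forall>i<length a. a ! i > 0 \<and> (\<forall>j<i. a ! j \<noteq> a ! i) \<longrightarrow>
        (\<exists>i1 i2. i1 < i \<and> i < i2 \<and> i2 < length a \<and> a ! i1 = a ! i - 1 \<and> a ! i2 = a ! i - 1))"
    (is "_ \<longleftrightarrow> ?R")
  proof
    assume *: "\<forall>k. straddled k a"
    show ?R
    proof (intro allI impI)
      fix i assume i: "i < length a" "a ! i > 0 \<and> (\<forall>j<i. a ! j \<noteq> a ! i)"
      with straddled_nth[of i a "a ! i - 1"] *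
      show "\<exists>i1 i2. i1 < i \<and> i < i2 \<and> i2 < length a \<and> a ! i1 = a ! i - 1 \<and> a ! i2 = a ! i - 1"
        by simp
    qed
  next
    assume R: ?R
    show "\<forall>k. straddled k a"
    proof
      fix k
      show "straddled k a"
      proof (cases "Suc k \<in> set a")
        case True
        then obtain p q where pq: "a = p @ Suc k # q" "Suc k \<notin> set p"
          by (metis split_list_first)
        have i: "length p < length a" "a ! length p = Suc k"
          "\<forall>j<length p. a ! j \<noteq> Suc k"
          using pq by (auto simp: nth_append dest: nth_mem)
        show ?thesis
          unfolding straddled_nth[OF i] using R[rule_format, of "length p"] i by simp
      qed (simp add: straddled_def)
    qed
  qed
  ultimately show ?thesis unfolding words_def by auto
qed

text \<open>
  The requirement on \<open>k + 1\<close> does not see letters other than \<open>k\<close> and \<open>k + 1\<close>; this locality is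
  what makes the decomposition of words possible.
\<close>

lemma straddled_filter:
  assumes "P k" "P (Suc k)"
  shows "straddled k (filter P a) \<longleftrightarrow> straddled k a"
proof -
  have "set (takeWhile (\<lambda>x. x \<noteq> Suc k) (filter P a)) =
        set (filter P (takeWhile (\<lambda>x. x \<noteq> Suc k) a))"
    using assms by (induction a) auto
  moreover have "set (dropWhile (\<lambda>x. x \<noteq> Suc k) (filter P a)) =
        set (filter P (dropWhile (\<lambda>x. x \<noteq> Suc k) a))"
    using assms by (induction a) auto
  ultimately show ?thesis using assms by (auto simp: straddled_def)
qed

lemma straddled_map_Suc: "straddled (Suc k) (map Suc a) \<longleftrightarrow> straddled k a"
proof -
  have "takeWhile (\<lambda>x. x \<noteq> Suc (Suc k)) (map Suc a) = map Suc (takeWhile (\<lambda>x. x \<noteq> Suc k) a)"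
       "dropWhile (\<lambda>x. x \<noteq> Suc (Suc k)) (map Suc a) = map Suc (dropWhile (\<lambda>x. x \<noteq> Suc k) a)"
    by (simp_all add: takeWhile_map dropWhile_map o_def)
  then show ?thesis by (auto simp: straddled_def)
qed

section \<open>Splitting a word into its bottom and its upper part\<close>

definition bottom :: "nat list \<Rightarrow> nat list" where
  "bottom a = filter (\<lambda>x. x \<le> 1) a"

definition upper :: "nat list \<Rightarrow> nat list" where
  "upper a = map (\<lambda>x. x - 1) (filter (\<lambda>x. 1 \<le> x) a)"

text \<open>
  The inverse of the splitting. The zeros of the upper part stand for the ones of the word, so
  they consume the ones of the bottom. A 0 of the bottom is written at once, before any pending
  large letter, because a large letter must not be followed by 0. The third equation is a default:
  it is not reached when the bottom has as many ones as the upper part has zeros.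
\<close>

fun merge :: "nat list \<Rightarrow> nat list \<Rightarrow> nat list" where
  "merge [] c = map Suc c"
| "merge (0 # s) c = 0 # merge s c"
| "merge (Suc y # s) [] = []"
| "merge (Suc y # s) (0 # c) = 1 # merge s c"
| "merge (Suc y # s) (Suc x # c) = Suc (Suc x) # merge (Suc y # s) c"

lemma bottom_merge:
  "set s \<subseteq> {0, 1} \<Longrightarrow> count_list s 1 = count_list c 0 \<Longrightarrow> bottom (merge s c) = s"
  by (induction s c rule: merge.induct)
     (auto simp: bottom_def filter_empty_conv count_list_0_iff Suc_le_eq
        dest: sym[of 0] intro!: Nat.gr0I)

lemma upper_merge:
  "set s \<subseteq> {0, 1} \<Longrightarrow> count_list s 1 = count_list c 0 \<Longrightarrow> upper (merge s c) = c"
  by (induction s c rule: merge.induct) (auto simp: upper_def o_def)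

lemma successively_merge:
  assumes "set s \<subseteq> {0, 1}" "count_list s 1 = count_list c 0"
    "successively (\<lambda>x y. x \<le> Suc y) c"
  shows "successively (\<lambda>x y. x \<le> Suc y) (merge s c)"
  using assms
proof (induction s c rule: merge.induct)
  case (5 y s x c)
  from 5 have "c \<noteq> []" by auto
  then have "hd (merge (Suc y # s) c) = Suc (hd c)"
    using 5 by (cases c; cases "hd c") auto
  with 5 \<open>c \<noteq> []\<close> show ?case by (auto simp: successively_Cons)
qed (auto simp: successively_map successively_Cons)

text \<open>
  From a letter that is at least 2 the word cannot reach 0 without passing through 1.
\<close>

lemma bottom_after_high:
  assumes "successively (\<lambda>x y. x \<le> Suc y) (x # a)" "2 \<le> x" "bottom a \<noteq> []"
  shows "hd (bottom a) = 1"
  using assms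
proof (induction a arbitrary: x)
  case (Cons y a)
  then show ?case by (cases "2 \<le> y") (auto simp: bottom_def)
qed (simp add: bottom_def)

text \<open>
  The descent condition alone makes the interleaving unique. Only a leading large letter needs an
  argument: \<^const>\<open>merge\<close> emits it first because the bottom then is empty or starts with 1.
\<close>

lemma merge_bottom_upper:
  "successively (\<lambda>x y. x \<le> Suc y) a \<Longrightarrow> merge (bottom a) (upper a) = a"
proof (induction a)
  case (Cons x a)
  then have IH: "merge (bottom a) (upper a) = a" by (auto simp: successively_Cons)
  consider "x = 0" | "x = 1" | "2 \<le> x" by linarith
  then show ?case
  proof cases
    case 3
    then have eq: "bottom (x # a) = bottom a" "upper (x # a) = (x - 1) # upper a"
      by (auto simp: bottom_def upper_def)
    obtain z where z: "x = Suc (Suc z)" using 3 by (metis numeral_2_eq_2 le_Suc_ex add_Suc)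
    show ?thesis
    proof (cases "bottom a")
      case Nil
      then show ?thesis using IH 3 by (simp add: eq)
    next
      case (Cons y s)
      then have "y = Suc 0" using bottom_after_high[OF Cons.prems 3] by simp
      then show ?thesis using IH Cons by (simp add: eq, simp add: z)
    qed
  qed (use IH in \<open>auto simp: bottom_def upper_def\<close>)
qed (simp add: bottom_def upper_def)

lemma count_bottom:
  "count_list (bottom a) 0 = count_list a 0" "count_list (bottom a) 1 = count_list a 1"
  by (induction a) (auto simp: bottom_def)

lemma count_upper: "count_list (upper a) 0 = count_list a 1"
  by (induction a) (auto simp: upper_def)

lemma length_upper: "length a = count_list a 0 + length (upper a)"
  by (induction a) (auto simp: upper_def)

lemma straddled_split:
  "(\<forall>k. straddled k a) \<longleftrightarrow> straddled 0 (bottom a) \<and> (\<forall>k. straddled k (upper a))"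
proof -
  have "map Suc (upper a) = filter (\<lambda>x. 1 \<le> x) a"
    by (induction a) (auto simp: upper_def)
  then have "straddled k (upper a) \<longleftrightarrow> straddled (Suc k) a" for k
    using straddled_map_Suc[of k "upper a"] straddled_filter[of "\<lambda>x. 1 \<le> x" "Suc k" a] by simp
  moreover have "straddled 0 (bottom a) \<longleftrightarrow> straddled 0 a"
    unfolding bottom_def by (rule straddled_filter) auto
  ultimately show ?thesis by (metis not0_implies_Suc)
qed

text \<open>
  Removing zeros creates no new large descent, since only letters that are at most 1 precede a 0.
\<close>

lemma successively_upper:
  "successively (\<lambda>x y. x \<le> Suc y) a \<Longrightarrow> successively (\<lambda>x y. x \<le> Suc y) (upper a)"
proof (induction a)
  case (Cons x a)
  then show ?case
    by (cases a) (auto simp: upper_def successively_Cons split: if_splits)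
qed (simp add: upper_def)

section \<open>Counting words by their zeros and ones\<close>

definition zeros_count :: "nat \<Rightarrow> nat \<Rightarrow> nat" where
  "zeros_count n m = card {a \<in> words n. count_list a 0 = m}"

text \<open>
  The possible bottoms of words with \<open>z\<close> zeros and \<open>m\<close> ones.
\<close>

definition skeletons :: "nat \<Rightarrow> nat \<Rightarrow> nat list set" where
  "skeletons z m = {s. set s \<subseteq> {0, 1} \<and> count_list s 0 = z \<and> count_list s 1 = m \<and> straddled 0 s}"

lemma bij_betw_bottom_upper:
  assumes "z \<le> n"
  shows "bij_betw (\<lambda>a. (bottom a, upper a))
    {a \<in> words n. count_list a 0 = z \<and> count_list a 1 = m}
    (skeletons z m \<times> {c \<in> words (n - z). count_list c 0 = m})"
proof (rule bij_betw_byWitness[where f' = "\<lambda>(s, c). merge s c"])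
  show "\<forall>a \<in> {a \<in> words n. count_list a 0 = z \<and> count_list a 1 = m}.
      (case (bottom a, upper a) of (s, c) \<Rightarrow> merge s c) = a"
    by (auto simp: words_iff merge_bottom_upper)
  show "\<forall>p \<in> skeletons z m \<times> {c \<in> words (n - z). count_list c 0 = m}.
      (bottom (case p of (s, c) \<Rightarrow> merge s c), upper (case p of (s, c) \<Rightarrow> merge s c)) = p"
    by (auto simp: skeletons_def bottom_merge upper_merge)
  show "(\<lambda>a. (bottom a, upper a)) ` {a \<in> words n. count_list a 0 = z \<and> count_list a 1 = m}
      \<subseteq> skeletons z m \<times> {c \<in> words (n - z). count_list c 0 = m}"
  proof (rule image_subsetI)
    fix a assume "a \<in> {a \<in> words n. count_list a 0 = z \<and> count_list a 1 = m}"
    then have a: "length a = n" "successively (\<lambda>x y. x \<le> Suc y) a" "\<forall>k. straddled k a"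
        "count_list a 0 = z" "count_list a 1 = m"
      by (auto simp: words_iff)
    have "set (bottom a) \<subseteq> {0, 1}" by (auto simp: bottom_def)
    then show "(bottom a, upper a) \<in> skeletons z m \<times> {c \<in> words (n - z). count_list c 0 = m}"
      using a straddled_split[of a] successively_upper[of a] length_upper[of a]
      by (auto simp: skeletons_def words_iff count_bottom[unfolded One_nat_def] count_upper)
  qed
  show "(\<lambda>(s, c). merge s c) ` (skeletons z m \<times> {c \<in> words (n - z). count_list c 0 = m})
      \<subseteq> {a \<in> words n. count_list a 0 = z \<and> count_list a 1 = m}"
  proof (rule image_subsetI)
    fix p assume "p \<in> skeletons z m \<times> {c \<in> words (n - z). count_list c 0 = m}"
    then obtain s c where p: "p = (s, c)" "s \<in> skeletons z m" "c \<in> words (n - z)" "count_list c 0 = m"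
      by auto
    have bu: "bottom (merge s c) = s" "upper (merge s c) = c"
      using p by (auto simp: skeletons_def bottom_merge upper_merge)
    have counts: "count_list (merge s c) 0 = z" "count_list (merge s c) 1 = m"
      using count_bottom[of "merge s c"] p by (auto simp: bu skeletons_def)
    moreover have "length (merge s c) = n"
      using length_upper[of "merge s c"] assms p by (simp add: bu counts words_iff)
    moreover have "successively (\<lambda>x y. x \<le> Suc y) (merge s c)"
      using p by (intro successively_merge) (auto simp: skeletons_def words_iff)
    moreover have "\<forall>k. straddled k (merge s c)"
      using straddled_split[of "merge s c"] p by (simp add: bu skeletons_def words_iff)
    ultimately show "(case p of (s, c) \<Rightarrow> merge s c)
        \<in> {a \<in> words n. count_list a 0 = z \<and> count_list a 1 = m}"
      by (simp add: p words_iff)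
  qed
qed

lemma card_words_zeros_ones:
  assumes "z \<le> n"
  shows "card {a \<in> words n. count_list a 0 = z \<and> count_list a 1 = m} =
    card (skeletons z m) * zeros_count (n - z) m"
  using bij_betw_same_card[OF bij_betw_bottom_upper[OF assms, of m]]
  by (simp add: card_cartesian_product zeros_count_def)

definition binary_words :: "nat \<Rightarrow> nat \<Rightarrow> nat list set" where
  "binary_words z m = {s. set s \<subseteq> {0, 1} \<and> count_list s 0 = z \<and> count_list s 1 = m}"

lemma binary_words_no_ones: "binary_words z 0 = {replicate z 0}"
proof -
  have "set s \<subseteq> {0, 1} \<and> count_list s 1 = 0 \<Longrightarrow> s = replicate (count_list s 0) 0" for s :: "nat list"
    by (induction s) (auto split: if_splits)
  moreover have "count_list (replicate z (0::nat)) 0 = z" "count_list (replicate z (0::nat)) 1 = 0"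
    by (induction z) auto
  ultimately show ?thesis unfolding binary_words_def by auto
qed

lemma binary_words_no_zeros: "binary_words 0 m = {replicate m 1}"
proof -
  have "set s \<subseteq> {0, 1} \<and> count_list s 0 = 0 \<Longrightarrow> s = replicate (count_list s 1) 1" for s :: "nat list"
    by (induction s) (auto split: if_splits)
  moreover have "count_list (replicate m (1::nat)) 1 = m" "count_list (replicate m (1::nat)) 0 = 0"
    by (induction m) auto
  ultimately show ?thesis unfolding binary_words_def by auto
qed

lemma binary_words_Suc_Suc:
  "binary_words (Suc z) (Suc m) =
     (#) 0 ` binary_words z (Suc m) \<union> (#) 1 ` binary_words (Suc z) m" (is "?L = ?R")
proof
  show "?L \<subseteq> ?R"
  proof
    fix s assume s: "s \<in> ?L"
    then obtain x t where "s = x # t" by (cases s) (auto simp: binary_words_def)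
    with s show "s \<in> ?R" by (cases "x = 0") (auto simp: binary_words_def)
  qed
qed (auto simp: binary_words_def)

lemma finite_card_binary_words:
  "finite (binary_words z m) \<and> card (binary_words z m) = (z + m) choose m"
proof (induction "z + m" arbitrary: z m)
  case 0
  then show ?case by (simp add: binary_words_no_ones)
next
  case (Suc k)
  show ?case
  proof (cases "z = 0 \<or> m = 0")
    case True
    then show ?thesis by (auto simp: binary_words_no_ones binary_words_no_zeros)
  next
    case False
    then obtain z' m' where zm: "z = Suc z'" "m = Suc m'" by (metis not0_implies_Suc)
    have IH: "finite (binary_words z' m)" "card (binary_words z' m) = (z' + m) choose m"
      "finite (binary_words z m')" "card (binary_words z m') = (z + m') choose m'"
      using Suc.hyps(1)[of z' m] Suc.hyps(1)[of z m'] Suc.hyps(2) zm by auto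
    have "card (binary_words z m) = card (binary_words z' m) + card (binary_words z m')"
      unfolding zm binary_words_Suc_Suc using IH
      by (subst card_Un_disjoint) (auto simp: zm card_image)
    then show ?thesis using IH by (simp add: zm binary_words_Suc_Suc)
  qed
qed

text \<open>
  Among the words that remain when a leading 0 is removed, exactly one has no 0 after its first 1;
  it is responsible for the summand \<open>- 1\<close> in the final formula.
\<close>

lemma not_straddled_unique:
  assumes "t \<in> binary_words z m"
  shows "0 \<notin> set (dropWhile (\<lambda>x. x \<noteq> 1) t) \<longleftrightarrow> t = replicate z 0 @ replicate m 1"
proof
  assume *: "0 \<notin> set (dropWhile (\<lambda>x. x \<noteq> 1) t)"
  have "\<forall>x \<in> set (takeWhile (\<lambda>x. x \<noteq> 1) t). x = 0"
    using assms by (auto simp: binary_words_def dest!: set_takeWhileD)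
  then obtain i where i: "takeWhile (\<lambda>x. x \<noteq> 1) t = replicate i 0"
    by (metis replicate_length_same)
  have "\<forall>x \<in> set (dropWhile (\<lambda>x. x \<noteq> 1) t). x = 1"
    using assms * by (metis (mono_tags, lifting) binary_words_def empty_iff insert_iff mem_Collect_eq set_dropWhileD subsetD)
  then obtain j where j: "dropWhile (\<lambda>x. x \<noteq> 1) t = replicate j 1"
    by (metis replicate_length_same)
  have t: "t = replicate i 0 @ replicate j 1"
    using takeWhile_dropWhile_id[of "\<lambda>x. x \<noteq> 1" t] unfolding i j by simp
  have "replicate i (0::nat) \<in> binary_words i 0" "replicate j (1::nat) \<in> binary_words 0 j"
    by (simp_all add: binary_words_no_ones binary_words_no_zeros)
  then have "i = z" "j = m" using assms by (auto simp: t binary_words_def)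
  with t show "t = replicate z 0 @ replicate m 1" by simp
next
  assume "t = replicate z 0 @ replicate m 1"
  then show "0 \<notin> set (dropWhile (\<lambda>x. x \<noteq> 1) t)"
    by (auto simp: dropWhile_append dest: set_dropWhileD)
qed

lemma skeletons_Suc_Suc:
  "skeletons (Suc z) (Suc m) = (#) 0 ` (binary_words z (Suc m) - {replicate z 0 @ replicate (Suc m) 1})"
  (is "_ = (#) 0 ` (_ - {?t0})")
proof -
  have cons: "0 # t \<in> skeletons (Suc z) (Suc m) \<longleftrightarrow> t \<in> binary_words z (Suc m) - {?t0}" for t
  proof -
    have "t \<in> binary_words z (Suc m) \<Longrightarrow> Suc 0 \<in> set t"
      by (rule ccontr) (auto simp: binary_words_def)
    then show ?thesis
      using not_straddled_unique[of t z "Suc m"]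
      by (auto simp: skeletons_def binary_words_def straddled_def)
  qed
  have "\<exists>t. s = 0 # t" if s: "s \<in> skeletons (Suc z) (Suc m)" for s
  proof (cases s)
    case (Cons x t)
    with s show ?thesis by (cases "x = 0") (auto simp: skeletons_def straddled_def)
  qed (use s in \<open>auto simp: skeletons_def\<close>)
  with cons show ?thesis by blast
qed

lemma card_skeletons:
  assumes "m > 0"
  shows "card (skeletons (Suc z) m) = ((z + m) choose m) - 1"
proof -
  obtain m' where m: "m = Suc m'" using assms by (metis gr0_implies_Suc)
  have "replicate z 0 @ replicate m 1 \<in> binary_words z m"
    using binary_words_no_ones[of z] binary_words_no_zeros[of m]
    by (auto simp: binary_words_def)
  then show ?thesis
    using finite_card_binary_words[of z m]
    unfolding m skeletons_Suc_Suc by (simp add: card_image)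
qed

lemma skeletons_no_ones: "skeletons z 0 = {replicate z 0}"
  using binary_words_no_ones[of z]
  by (auto simp: skeletons_def binary_words_def straddled_def)

lemma skeletons_no_zeros:
  assumes "m > 0"
  shows "skeletons 0 m = {}"
proof -
  have False if "s \<in> skeletons 0 m" for s
  proof -
    from that have "0 \<notin> set s" "1 \<in> set s" "straddled 0 s"
      using assms by (auto simp: skeletons_def count_list_0_iff intro: ccontr)
    then show False by (auto simp: straddled_def dest: set_takeWhileD)
  qed
  then show ?thesis by blast
qed

section \<open>Ballot numbers as coefficients of powers of the Catalan series\<close>

text \<open>
  The number \<open>ballot r k\<close> will turn out to be the coefficient of \<open>x^k\<close> in \<open>C(x)^r\<close>. The form as
  a difference of binomial coefficients makes the recurrence below an instance of Pascal's rule
  and is also right for \<open>r = 0\<close>, where the truncated subtraction only matters for \<open>k = 0\<close>.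
\<close>

definition ballot :: "nat \<Rightarrow> nat \<Rightarrow> rat" where
  "ballot r k = of_nat ((2 * k + r - 1) choose k) -
     (if k = 0 then 0 else of_nat ((2 * k + r - 1) choose (k - 1)))"

lemma ballot_0_right [simp]: "ballot r 0 = 1"
  by (simp add: ballot_def)

lemma ballot_0_left: "ballot 0 (Suc k) = 0"
  using binomial_symmetric[of k "2 * k + 1"] by (simp add: ballot_def)

text \<open>
  On the level of series this is \<open>C^(r+1) = C^r + x C^(r+2)\<close>.
\<close>

lemma ballot_Suc_Suc: "ballot (Suc r) (Suc k) = ballot r (Suc k) + ballot (Suc (Suc r)) k"
  by (cases k) (simp_all add: ballot_def)

lemma ballot_closed_form:
  assumes "r > 0"
  shows "ballot r k = of_nat r / of_nat (k + r) * of_nat ((2 * k + r - 1) choose k)"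
proof (cases k)
  case (Suc l)
  define n where "n = 2 * k + r - 1"
  have "Suc l * (n choose Suc l) = (n - l) * (n choose l)"
    by (metis binomial_absorb_comp binomial_absorption)
  moreover have "n - l = k + r" using assms by (simp add: n_def Suc)
  moreover have nz: "of_nat k + of_nat r \<noteq> (0 :: rat)"
    using assms by (simp flip: of_nat_add)
  ultimately have "of_nat (k * (n choose k)) = (of_nat ((k + r) * (n choose l)) :: rat)"
    by (simp only: Suc)
  then have *: "of_nat (n choose l) = (of_nat k / of_nat (k + r) * of_nat (n choose k) :: rat)"
    using nz by (simp add: field_simps)
  have "ballot r k = of_nat (n choose k) - of_nat (n choose l)"
    by (simp add: ballot_def n_def Suc)
  also have "\<dots> = of_nat r / of_nat (k + r) * of_nat (n choose k)"
    unfolding * using nz by (simp add: field_simps)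
  finally show ?thesis by (simp add: n_def)
qed (use assms in simp)

abbreviation Cat :: "rat fps" where
  "Cat \<equiv> Abs_fps catalan"

text \<open>
  The recurrence alone makes the row series multiplicative: the product of row \<open>r\<close> with a fixed
  row \<open>s\<close> satisfies the same recurrence in \<open>r\<close> as row \<open>r + s\<close>. In particular row \<open>r\<close> is the
  \<open>r\<close>-th power of row 1.
\<close>

lemma ballot_series_mult:
  "Abs_fps (ballot r) * Abs_fps (ballot s) = Abs_fps (ballot (r + s))"
proof -
  define F where "F = (\<lambda>r. Abs_fps (ballot r))"
  have F0: "F 0 = 1"
    by (rule fps_ext) (use ballot_0_left in \<open>auto simp: F_def gr0_conv_Suc\<close>)
  have rec: "F (Suc r) = F r + fps_X * F (Suc (Suc r))" for r
  proof (rule fps_ext)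
    fix k show "F (Suc r) $ k = (F r + fps_X * F (Suc (Suc r))) $ k"
      by (cases k) (simp_all add: F_def ballot_Suc_Suc)
  qed
  have "(F r * F s) $ k = F (r + s) $ k" for k
  proof (induction k arbitrary: r s)
    case (Suc k)
    show ?case
    proof (induction r)
      case (Suc r)
      have "F (Suc r) * F s = F r * F s + fps_X * (F (Suc (Suc r)) * F s)"
        by (subst rec) (simp add: algebra_simps)
      then have "(F (Suc r) * F s) $ Suc k = (F r * F s) $ Suc k + (F (Suc (Suc r)) * F s) $ k"
        by simp
      also have "\<dots> = F (r + s) $ Suc k + F (Suc (Suc (r + s))) $ k"
        using Suc.IH \<open>\<And>r s. (F r * F s) $ k = F (r + s) $ k\<close> by simp
      also have "\<dots> = F (Suc r + s) $ Suc k"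
        using rec[of "r + s"] by (simp add: F_def ballot_Suc_Suc)
      finally show ?case .
    qed (simp add: F0)
  qed (simp add: F_def)
  then show ?thesis by (intro fps_ext) (simp add: F_def)
qed

lemma Cat_eq_ballot: "Cat = Abs_fps (ballot 1)"
proof (rule fps_ext)
  fix k
  show "Cat $ k = Abs_fps (ballot 1) $ k"
    using ballot_closed_form[of 1 k] by (simp add: catalan_def)
qed

lemma Cat_power: "Cat ^ r = Abs_fps (ballot r)"
proof (induction r)
  case 0
  show ?case
    by (rule fps_ext) (use ballot_0_left in \<open>auto simp: gr0_conv_Suc\<close>)
next
  case (Suc r)
  then show ?case
    using ballot_series_mult[of 1 r] by (simp add: Cat_eq_ballot)
qed

lemma Cat_unfold: "Cat = 1 + fps_X * Cat ^ 2"
proof (rule fps_ext)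
  fix k
  show "Cat $ k = (1 + fps_X * Cat ^ 2) $ k"
    unfolding Cat_power unfolding Cat_eq_ballot
    using ballot_Suc_Suc[of 0] by (cases k) (simp_all add: ballot_0_left numeral_2_eq_2)
qed

abbreviation geom :: "rat fps" where
  "geom \<equiv> inverse (1 - fps_X)"

lemma geom_mult: "geom * (1 - fps_X) = 1"
  by (intro inverse_mult_eq_1) simp

lemma geom_power_nth:
  assumes "m > 0"
  shows "(geom ^ m) $ i = of_nat ((m + i - 1) choose i)"
  using one_minus_const_fps_X_neg_power'[OF assms, of "1::rat"]
  by (simp add: fps_inverse_power)

lemma geom_power_shift_nth:
  "(fps_X ^ m * geom ^ Suc m) $ j = of_nat (j choose m)"
proof (cases "j < m")
  case False
  then have "(fps_X ^ m * geom ^ Suc m) $ j = of_nat (j choose (j - m))"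
    by (subst fps_X_power_mult_nth, subst geom_power_nth) simp_all
  then show ?thesis using False by (simp add: binomial_symmetric[of m j])
qed (simp add: fps_X_power_mult_nth)

text \<open>
  The identity that lets the ballot numbers solve the recurrence of the words. The binomial factors
  are the coefficients of \<open>A = ((1 - x)^(-(z+1)) - (1 - x)^(-1)) / x\<close>. Substituting \<open>x C\<close> for \<open>x\<close>
  turns \<open>1 / (1 - x)\<close> into \<open>C\<close>, so that \<open>x C\<close> times the substituted \<open>A\<close> is
  \<open>C^(z+1) - C\<close>; cancelling \<open>C\<close> leaves \<open>C^z - 1\<close>.
\<close>

lemma ballot_skeleton_sum:
  "(\<Sum>i\<le>k. (of_nat ((z + Suc i) choose Suc i) - 1) * ballot i (k - i)) = ballot z (Suc k)"
proof -
  define A where "A = fps_shift 1 (geom ^ Suc z - geom)"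
  have XA: "geom ^ Suc z - geom = fps_X * A"
    by (rule fps_ext) (auto simp: A_def fps_X_mult_nth fps_power_zeroth)
  have A_nth: "A $ i = of_nat ((z + Suc i) choose Suc i) - 1" for i
    unfolding A_def fps_shift_nth fps_sub_nth geom_power_nth[OF zero_less_Suc]
    using geom_power_nth[of 1 "i + 1"] by simp
  define Y where "Y = fps_X * Cat"
  have Y0: "Y $ 0 = 0" by (simp add: Y_def)
  have "Cat * (1 - Y) = 1"
    using Cat_unfold by (simp add: Y_def algebra_simps power2_eq_square)
  then have "inverse (1 - Y) = Cat"
    by (metis fps_inverse_unique mult.commute)
  then have geom_Y: "geom oo Y = Cat"
    using Y0 by (simp add: fps_inverse_compose fps_compose_sub_distrib)
  have "Cat * (fps_X * (A oo Y)) = (fps_X * A) oo Y"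
    using Y0 by (simp add: fps_compose_mult_distrib Y_def mult_ac)
  also have "\<dots> = Cat ^ Suc z - Cat"
    unfolding XA[symmetric] fps_compose_sub_distrib fps_compose_power[OF Y0, symmetric] geom_Y ..
  also have "\<dots> = Cat * (Cat ^ z - 1)" by (simp add: algebra_simps)
  finally have "Cat * (fps_X * (A oo Y)) = Cat * (Cat ^ z - 1)" .
  moreover have "Cat \<noteq> 0" using \<open>Cat * (1 - Y) = 1\<close> by auto
  ultimately have "fps_X * (A oo Y) = Cat ^ z - 1" by simp
  then have "(A oo Y) $ k = ballot z (Suc k)"
    by (metis (no_types, lifting) Cat_power fps_X_mult_nth diff_Suc_1 fps_nth_Abs_fps fps_sub_nth
        fps_one_nth nat.simps(3) diff_zero)
  moreover have "(Y ^ i) $ k = ballot i (k - i)" if "i \<le> k" for i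
    using that by (simp add: Y_def power_mult_distrib Cat_power fps_X_power_mult_nth)
  ultimately show ?thesis
    by (simp add: fps_compose_nth A_nth atLeast0AtMost)
qed

section \<open>The number of words with given zeros or ones\<close>

lemma first_letter_zero:
  assumes "a \<in> words n" "n > 0"
  shows "0 \<in> set a"
proof -
  from assms obtain x t where a: "a = x # t" by (cases a) (auto simp: words_iff)
  have "x = 0"
  proof (cases x)
    case (Suc k)
    have "straddled k a" using assms by (simp add: words_iff)
    then show ?thesis by (simp add: a Suc straddled_def)
  qed
  with a show ?thesis by simp
qed

lemma words_0: "words 0 = {[]}"
  by (auto simp: words_iff straddled_def)

lemma zeros_count_0: "zeros_count n 0 = (if n = 0 then 1 else 0)"
proof (cases "n = 0")
  case False
  then have "{a \<in> words n. count_list a 0 = 0} = {}"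
    using first_letter_zero by (auto simp: count_list_0_iff)
  with False show ?thesis by (simp only: zeros_count_def card.empty if_False)
next
  case True
  have "{a \<in> words 0. count_list a 0 = 0} = {[]}" by (auto simp: words_0)
  then show ?thesis using True by (simp add: zeros_count_def)
qed

lemma zeros_count_eq_0:
  assumes "n < m"
  shows "zeros_count n m = 0"
proof -
  have "count_list a 0 \<noteq> m" if "a \<in> words n" for a
    using that assms count_le_length[of a 0] by (auto simp: words_iff)
  then have "{a \<in> words n. count_list a 0 = m} = {}" by blast
  then show ?thesis by (simp only: zeros_count_def card.empty)
qed

lemma zeros_count_rec:
  "zeros_count (z + k) z = (\<Sum>m\<le>k. card (skeletons z m) * zeros_count k m)"
proof -
  let ?W = "\<lambda>m. {a \<in> words (z + k). count_list a 0 = z \<and> count_list a 1 = m}"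
  have "count_list a 1 \<le> k" if "a \<in> words (z + k)" "count_list a 0 = z" for a
    using that length_upper[of a] count_le_length[of "upper a" 0]
    by (simp add: words_iff count_upper)
  then have "{a \<in> words (z + k). count_list a 0 = z} = (\<Union>m\<le>k. ?W m)" by auto
  then have "zeros_count (z + k) z = (\<Sum>m\<le>k. card (?W m))"
    unfolding zeros_count_def
    by (simp, subst card_UN_disjoint) (auto simp: finite_words)
  then show ?thesis by (simp add: card_words_zeros_ones del: One_nat_def)
qed

lemma b_rec: "b n m = (\<Sum>z\<le>n. card (skeletons z m) * zeros_count (n - z) m)"
proof -
  let ?W = "\<lambda>z. {a \<in> words n. count_list a 0 = z \<and> count_list a 1 = m}"
  have "count_list a 0 \<le> n" if "a \<in> words n" for a
    using that count_le_length[of a 0] by (simp add: words_iff)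
  then have "{a \<in> words n. count_list a 1 = m} = (\<Union>z\<le>n. ?W z)" by auto
  then have "b n m = (\<Sum>z\<le>n. card (?W z))"
    unfolding b_def
    by (simp, subst card_UN_disjoint) (auto simp: finite_words)
  then show ?thesis by (simp add: card_words_zeros_ones del: One_nat_def)
qed

lemma of_nat_card_skeletons:
  assumes "m > 0"
  shows "(of_nat (card (skeletons (Suc z) m)) :: rat) = of_nat ((z + m) choose m) - 1"
proof -
  have "(z + m) choose m \<ge> 1" by (simp add: Suc_le_eq)
  then show ?thesis by (simp add: card_skeletons[OF assms] of_nat_diff)
qed

text \<open>
  The upper part of a word with \<open>z + 1\<close> zeros has length \<open>k\<close>, and it contains a zero unless
  \<open>k = 0\<close>; the induction hypothesis therefore applies to it with a smaller excess over its zeros.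
\<close>

lemma zeros_count_eq_ballot: "of_nat (zeros_count (Suc z + k) (Suc z)) = ballot z k"
proof (induction k arbitrary: z rule: less_induct)
  case (less k)
  show ?case
  proof (cases k)
    case 0
    have "zeros_count (Suc z) (Suc z) = 1"
      using zeros_count_rec[of "Suc z" 0] by (simp add: skeletons_no_ones zeros_count_0)
    then show ?thesis using 0 by simp
  next
    case (Suc l)
    have "(of_nat (zeros_count (Suc z + k) (Suc z)) :: rat)
        = (\<Sum>i\<le>l. of_nat (card (skeletons (Suc z) (Suc i))) * of_nat (zeros_count k (Suc i)))"
      unfolding zeros_count_rec by (simp add: Suc sum.atMost_Suc_shift zeros_count_0 del: sum.atMost_Suc)
    also have "\<dots> = (\<Sum>i\<le>l. (of_nat ((z + Suc i) choose Suc i) - 1) * ballot i (l - i))"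
    proof (intro sum.cong refl)
      fix i assume "i \<in> {..l}"
      then have k: "Suc i + (l - i) = k" and lt: "l - i < k" using Suc by auto
      have "of_nat (zeros_count k (Suc i)) = ballot i (l - i)"
        using less.IH[OF lt, of i] unfolding k .
      then show "of_nat (card (skeletons (Suc z) (Suc i))) * of_nat (zeros_count k (Suc i)) =
          (of_nat ((z + Suc i) choose Suc i) - 1) * ballot i (l - i)"
        by (simp only: of_nat_card_skeletons[OF zero_less_Suc])
    qed
    also have "\<dots> = ballot z k" unfolding Suc by (rule ballot_skeleton_sum)
    finally show ?thesis .
  qed
qed

lemma b_no_ones: "b n 0 = 1"
proof -
  have "b n 0 = (\<Sum>z\<le>n. if z = n then 1 else 0)"
    unfolding b_rec by (intro sum.cong) (auto simp: skeletons_no_ones zeros_count_0)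
  then show ?thesis by simp
qed

text \<open>
  The index \<open>j\<close> counts the letters 0 and 1 other than the leading 0, and \<open>n - j\<close> counts the
  letters that are at least 2.
\<close>

lemma b_eq_ballot_sum:
  assumes "m > 0"
  shows "of_nat (b (Suc n) m) = (\<Sum>j = m..n. ballot (m - 1) (n - j) * (of_nat (j choose m) - 1))"
proof -
  have "(of_nat (b (Suc n) m) :: rat)
      = (\<Sum>z\<le>n. (of_nat ((z + m) choose m) - 1) * of_nat (zeros_count (n - z) m))"
    unfolding b_rec
    by (simp add: sum.atMost_Suc_shift skeletons_no_zeros[OF assms] of_nat_card_skeletons[OF assms]
        del: sum.atMost_Suc)
  also have "\<dots> = (\<Sum>z | z + m \<le> n. (of_nat ((z + m) choose m) - 1) * of_nat (zeros_count (n - z) m))"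
    by (intro sum.mono_neutral_right) (auto intro!: zeros_count_eq_0)
  also have "\<dots> = (\<Sum>j = m..n. ballot (m - 1) (n - j) * (of_nat (j choose m) - 1))"
  proof (rule sum.reindex_bij_witness[where i = "\<lambda>j. j - m" and j = "\<lambda>z. z + m"])
    fix z assume "z \<in> {z. z + m \<le> n}"
    then have nz: "m + (n - (z + m)) = n - z" and m: "Suc (m - 1) = m"
      using assms by auto
    have "of_nat (zeros_count (n - z) m) = ballot (m - 1) (n - (z + m))"
      using zeros_count_eq_ballot[of "m - 1" "n - (z + m)"] unfolding m nz .
    then show "ballot (m - 1) (n - (z + m)) * (of_nat ((z + m) choose m) - 1) =
        (of_nat ((z + m) choose m) - 1) * of_nat (zeros_count (n - z) m)"
      by simp
  qed auto
  finally show ?thesis .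
qed

section \<open>The generating function\<close>

text \<open>
  The embedding of power series in \<open>x\<close> into power series in \<open>x\<close> and \<open>v\<close>. Multiplication by a
  lifted series acts on each coefficient of a power of \<open>v\<close> separately, so identities of bivariate
  series can be checked one power of \<open>v\<close> at a time.
\<close>

definition lift :: "rat fps \<Rightarrow> rat fps fps" where
  "lift f = Abs_fps (\<lambda>n. fps_const (f $ n))"

lemma lift_mult: "lift (f * g) = lift f * lift g"
proof (intro fps_ext)
  fix n m show "lift (f * g) $ n $ m = (lift f * lift g) $ n $ m"
    by (cases m) (simp_all add: lift_def fps_mult_nth fps_sum_nth)
qed

lemma lift_simps:
  "lift (f * g) = lift f * lift g" "lift (f - g) = lift f - lift g" "lift 1 = 1" "lift fps_X = fps_X"
  by (rule lift_mult) (rule fps_ext; simp add: lift_def; fail)+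

definition vcoeff :: "nat \<Rightarrow> rat fps fps \<Rightarrow> rat fps" where
  "vcoeff m F = Abs_fps (\<lambda>n. F $ n $ m)"

lemma vcoeff_eqI: "(\<And>m. vcoeff m F = vcoeff m G) \<Longrightarrow> F = G"
  by (simp add: vcoeff_def fps_eq_iff)

lemma vcoeff_simps:
  "vcoeff m (F + G) = vcoeff m F + vcoeff m G"
  "vcoeff m (F - G) = vcoeff m F - vcoeff m G"
  "vcoeff m 1 = (if m = 0 then 1 else 0)"
  "vcoeff 0 (v_var * F) = 0"
  "vcoeff (Suc m) (v_var * F) = vcoeff m F"
  by (rule fps_ext; simp add: vcoeff_def; fail)+

lemma vcoeff_lift_mult: "vcoeff m (lift f * F) = f * vcoeff m F"
proof (rule fps_ext)
  fix n
  have "(lift f * F) $ n $ m = (\<Sum>i = 0..n. (fps_const (f $ i) * F $ (n - i)) $ m)"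
    unfolding fps_mult_nth[of "lift f"] fps_sum_nth by (simp add: lift_def)
  then show "vcoeff m (lift f * F) $ n = (f * vcoeff m F) $ n"
    by (simp add: vcoeff_def fps_mult_nth[of f])
qed

text \<open>
  The geometric series \<open>1 / (1 - v q)\<close>. As a family of coefficients in \<open>v\<close> it makes sense also when
  \<open>q\<close> has a constant term.
\<close>

definition vgeom :: "rat fps \<Rightarrow> rat fps fps" where
  "vgeom q = Abs_fps (\<lambda>n. Abs_fps (\<lambda>m. (q ^ m) $ n))"

lemma vcoeff_vgeom [simp]: "vcoeff m (vgeom q) = q ^ m"
  by (rule fps_ext) (simp add: vcoeff_def vgeom_def)

lemma vgeom_mult: "vgeom q * (1 - v_var * lift q) = 1"
proof -
  have "vgeom q - v_var * (lift q * vgeom q) = 1"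
  proof (rule vcoeff_eqI)
    fix m show "vcoeff m (vgeom q - v_var * (lift q * vgeom q)) = vcoeff m 1"
      by (cases m) (simp_all add: vcoeff_simps vcoeff_lift_mult)
  qed
  then show ?thesis by (simp add: algebra_simps)
qed

lemma vcoeff_B_series_0: "vcoeff 0 B_series = fps_X * geom"
proof (rule fps_ext)
  fix n show "vcoeff 0 B_series $ n = (fps_X * geom) $ n"
    using geom_power_nth[of 1 "n - 1"] by (simp add: vcoeff_def B_series_def b_no_ones)
qed

lemma vcoeff_B_series_Suc:
  "vcoeff (Suc m) B_series = fps_X * (fps_X ^ Suc m * (geom ^ Suc (Suc m) - geom) * Cat ^ m)"
proof (rule fps_ext)
  fix n
  show "vcoeff (Suc m) B_series $ n =
      (fps_X * (fps_X ^ Suc m * (geom ^ Suc (Suc m) - geom) * Cat ^ m)) $ n"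
  proof (cases n)
    case (Suc k)
    define H where "H = fps_X ^ Suc m * (geom ^ Suc (Suc m) - geom)"
    have H: "H $ j = (if Suc m \<le> j then of_nat (j choose Suc m) - 1 else 0)" for j
    proof -
      have "H $ j = (fps_X ^ Suc m * geom ^ Suc (Suc m)) $ j - (fps_X ^ Suc m * geom) $ j"
        by (simp only: H_def right_diff_distrib fps_sub_nth)
      also have "\<dots> = of_nat (j choose Suc m) - (if j < Suc m then 0 else 1)"
        unfolding geom_power_shift_nth unfolding fps_X_power_mult_nth
        using geom_power_nth[of 1 "j - Suc m"] by simp
      finally show ?thesis by auto
    qed
    have "vcoeff (Suc m) B_series $ n = of_nat (b (Suc k) (Suc m))"
      using b_eq_ballot_sum[of "Suc m" k] by (auto simp: vcoeff_def B_series_def Suc)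
    also have "\<dots> = (\<Sum>j = Suc m..k. H $ j * ballot m (k - j))"
      by (simp add: b_eq_ballot_sum H mult.commute)
    also have "\<dots> = (\<Sum>j = 0..k. H $ j * ballot m (k - j))"
      by (intro sum.mono_neutral_left) (auto simp: H)
    also have "\<dots> = (fps_X * (H * Cat ^ m)) $ n"
      by (simp add: Suc fps_mult_nth[of H] Cat_power)
    finally show ?thesis by (simp add: H_def)
  qed (simp add: vcoeff_def B_series_def)
qed

lemma B_series_eq:
  "B_series = lift (fps_X * geom) * (1 + v_var * (lift fps_X *
     (lift geom * vgeom (fps_X * Cat * geom) - vgeom (fps_X * Cat))))"
proof (rule vcoeff_eqI)
  fix m
  show "vcoeff m B_series = vcoeff m (lift (fps_X * geom) * (1 + v_var * (lift fps_X *
     (lift geom * vgeom (fps_X * Cat * geom) - vgeom (fps_X * Cat)))))"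
  proof (cases m)
    case 0
    then show ?thesis by (simp only: vcoeff_simps vcoeff_lift_mult vcoeff_B_series_0) simp
  next
    case (Suc k)
    have "fps_X ^ Suc k * (geom ^ Suc (Suc k) - geom) * Cat ^ k =
        geom * (fps_X * (geom * (fps_X * Cat * geom) ^ k - (fps_X * Cat) ^ k))"
      by (simp add: power_mult_distrib algebra_simps)
    then show ?thesis
      by (simp add: Suc vcoeff_simps vcoeff_lift_mult vcoeff_B_series_Suc mult.assoc del: power_Suc)
  qed
qed

text \<open>
  The two geometric series are \<open>1 / (1 - y)\<close> and \<open>(1 - x) / (1 - x - y)\<close> with \<open>y = x v C\<close>, so
  \<open>B = x / (1 - x) (1 + x v (1 / (1 - x - y) - 1 / (1 - y)))\<close>, and clearing denominators gives the
  numerator \<open>x ((1 - y) (1 - x - y) + x^2 v)\<close>.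
\<close>

lemma B_series_times_denominator:
  "B_series * ((1 - x_var) * (1 - x_var * v_var * C_series) * (1 - x_var - x_var * v_var * C_series))
   = x_var * (1 - x_var + x_var ^ 2 * v_var + x_var * v_var * (x_var - 2) * C_series
               + x_var ^ 2 * v_var ^ 2 * C_series ^ 2)"
proof -
  define y where "y = x_var * v_var * C_series"
  define W where "W = lift geom"
  define G1 where "G1 = vgeom (fps_X * Cat * geom)"
  define G2 where "G2 = vgeom (fps_X * Cat)"
  have C: "C_series = lift Cat" by (simp add: C_series_def lift_def)
  have W: "W * (1 - x_var) = 1"
    using arg_cong[OF geom_mult, of lift] by (simp only: lift_simps W_def)
  have G2: "G2 * (1 - y) = 1"
    using vgeom_mult[of "fps_X * Cat"] by (simp add: G2_def y_def C lift_simps mult_ac)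
  have G1': "G1 * (1 - y * W) = 1"
    using vgeom_mult[of "fps_X * Cat * geom"]
    by (simp add: G1_def y_def C W_def lift_simps mult_ac)
  have factor: "1 - x_var - y = (1 - x_var) * (1 - y * W)"
  proof -
    have "(1 - x_var) * (1 - y * W) = (1 - x_var) - y * (W * (1 - x_var))"
      by (simp add: algebra_simps)
    then show ?thesis by (simp only: W mult_1_right)
  qed
  have "W * G1 * (1 - x_var - y) = (W * (1 - x_var)) * (G1 * (1 - y * W))"
    unfolding factor by (simp only: mult_ac)
  then have G1: "W * G1 * (1 - x_var - y) = 1"
    by (simp only: W G1' mult_1_right)
  \<comment> \<open>Each inverse is put next to the factor that it cancels; the three factors of the denominator
    are kept opaque for this.\<close>
  have regroup: "x_var * W * (1 + v_var * (x_var * (W * G1 - G2))) * (P * Q * R)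
      = x_var * (W * P) * (Q * R + v_var * x_var * ((W * G1 * R) * Q - (G2 * Q) * R))" for P Q R
    by (simp only: ring_distribs mult_ac mult_1 mult_1_right)
  have "B_series * ((1 - x_var) * (1 - y) * (1 - x_var - y))
    = x_var * (W * (1 - x_var)) * ((1 - y) * (1 - x_var - y) + v_var * x_var *
       ((W * G1 * (1 - x_var - y)) * (1 - y) - (G2 * (1 - y)) * (1 - x_var - y)))"
    unfolding B_series_eq W_def[symmetric] G1_def[symmetric] G2_def[symmetric] lift_simps
    using regroup[of "1 - x_var" "1 - y" "1 - x_var - y"] by (simp only: W_def[symmetric])
  also have "\<dots> = x_var * ((1 - y) * (1 - x_var - y) + v_var * x_var * x_var)"
    unfolding W G1 G2 by (simp add: algebra_simps)
  also have "\<dots> = x_var * (1 - x_var + x_var ^ 2 * v_var + y * (x_var - 2) + y ^ 2)"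
    by (simp add: algebra_simps power2_eq_square)
  finally show ?thesis by (simp add: y_def power_mult_distrib mult_ac)
qed

theorem corollary2p11:
  shows "B_series =
      x_var * (1 - x_var + x_var ^ 2 * v_var + x_var * v_var * (x_var - 2) * C_series
               + x_var ^ 2 * v_var ^ 2 * C_series ^ 2)
      / ((1 - x_var) * (1 - x_var * v_var * C_series) * (1 - x_var - x_var * v_var * C_series))
    \<and> (\<forall>n m :: nat. 2 \<le> m \<and> m \<le> n \<longrightarrow>
        (of_nat (b n m) :: rat) =
          (\<Sum>j = m..n - 1. (of_nat m - 1) / (of_nat n + of_nat m - of_nat j - 2)
             * of_nat ((2 * n + m - 2 * j - 4) choose (n - j - 1))
             * (of_nat (j choose m) - 1)))"
proof (intro conjI allI impI)
  let ?N = "x_var * (1 - x_var + x_var ^ 2 * v_var + x_var * v_var * (x_var - 2) * C_series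
               + x_var ^ 2 * v_var ^ 2 * C_series ^ 2)"
  let ?D = "(1 - x_var) * (1 - x_var * v_var * C_series) * (1 - x_var - x_var * v_var * C_series)"
  have D: "?D $ 0 = 1" by (simp add: mult.assoc)
  have nz: "?D \<noteq> 0"
  proof
    assume "?D = 0"
    with D show False by (simp only: fps_zero_nth zero_neq_one)
  qed
  have "?N / ?D * ?D = B_series * ?D"
    by (simp only: fps_fps_divide_unit[OF D] B_series_times_denominator)
  from iffD1[OF mult_right_cancel[OF nz] this] show "B_series = ?N / ?D" ..
next
  fix n m :: nat assume mn: "2 \<le> m \<and> m \<le> n"
  then obtain k where n: "n = Suc k" by (cases n) auto
  have "ballot (m - 1) (k - j) = (of_nat m - 1) / (of_nat n + of_nat m - of_nat j - 2)
      * of_nat ((2 * n + m - 2 * j - 4) choose (n - j - 1))" if "j \<in> {m..k}" for j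
  proof -
    have "2 * (k - j) + (m - 1) - 1 = 2 * n + m - 2 * j - 4" using that mn n by auto
    moreover have "(of_nat (k - j + (m - 1)) :: rat) = of_nat n + of_nat m - of_nat j - 2"
      using that mn n by (simp add: of_nat_diff)
    ultimately show ?thesis
      using ballot_closed_form[of "m - 1" "k - j"] mn n by (simp add: of_nat_diff)
  qed
  then show "(of_nat (b n m) :: rat) =
          (\<Sum>j = m..n - 1. (of_nat m - 1) / (of_nat n + of_nat m - of_nat j - 2)
             * of_nat ((2 * n + m - 2 * j - 4) choose (n - j - 1))
             * (of_nat (j choose m) - 1))"
    using b_eq_ballot_sum[of m k] mn n by simp
qed

end
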